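(* Let $R$ be an associative ring and let $I$ be a one-sided (left or right) ideal of $R$. If the subring $I$ is Lie nilpotent, then $I$ is contained in a Lie solvable two-sided ideal $J$ of $R$ such that $s(J)\le \frac{m(m+1)}{2}+m$, where $m=c(I)$ is the Lie nilpotency class of the subring $I$ and $s(J)$ is the Lie derived length of $J$.
   Context: Associative rings are not assumed to have an identity element, so one-sided ideals are subrings. For an associative ring $A$, $A^{(-)}$ denotes its adjoint Lie ring: the additive group of $A$ with bracket $[a,b]=ab-ba$. For additive subgroups $X,Y$, $[X,Y]$ denotes the additive subgroup generated by all $[x,y]$, $x\in X$, $y\in Y$. The lower central series of $A^{(-)}$ is $A^{(-)}_1=A$, $A^{(-)}_{k+1}=[A^{(-)}_k,A]$. The ring $A$ is Lie nilpotent if $A^{(-)}_{k+1}=0$ for some $k\ge 0$, and its Lie nilpotency class $c(A)$ is the least such $k$ (so $c(A)\le 1$ if and only if $A$ is commutative). The ring $A$ is Lie solvable if the Lie ring $A^{(-)}$ is solvable, i.e. the derived series $A^{(0)}=A$, $A^{(k+1)}=[A^{(k)},A^{(k)}]$ reaches $0$; its Lie derived length $s(A)$ is the least $k$ with $A^{(k)}=0$. An ideal is called Lie nilpotent or Lie solvable if it is so as a ring in its own right. *)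

theory Defs
  imports "HOL-Computational_Algebra.Group_Closure"
begin

text \<open>
  The type class \<open>ring\<close> does not require an identity element. The ambient ring is the whole type;
  its subrings and ideals are sets, with Lie notions taken with respect to the inherited operations.
\<close>

definition additive_subgroup :: "'a::ab_group_add set \<Rightarrow> bool" where
  "additive_subgroup H \<longleftrightarrow> 0 \<in> H \<and> (\<forall>x\<in>H. \<forall>y\<in>H. x - y \<in> H)"

definition left_ideal :: "'a::ring set \<Rightarrow> bool" where
  "left_ideal I \<longleftrightarrow> additive_subgroup I \<and> (\<forall>r. \<forall>x\<in>I. r * x \<in> I)"

definition right_ideal :: "'a::ring set \<Rightarrow> bool" where
  "right_ideal I \<longleftrightarrow> additive_subgroup I \<and> (\<forall>r. \<forall>x\<in>I. x * r \<in> I)"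

definition two_sided_ideal :: "'a::ring set \<Rightarrow> bool" where
  "two_sided_ideal I \<longleftrightarrow> left_ideal I \<and> right_ideal I"

definition lie_bracket :: "'a::ring \<Rightarrow> 'a \<Rightarrow> 'a" where
  "lie_bracket a b = a * b - b * a"

definition lie_product :: "'a::ring set \<Rightarrow> 'a set \<Rightarrow> 'a set" where
  "lie_product X Y = group_closure {lie_bracket x y | x y. x \<in> X \<and> y \<in> Y}"

text \<open>
  The lower central series is indexed from 0 here, so \<open>lie_lower_central A k\<close> is the term
  usually written with subscript \<open>k + 1\<close>, and the nilpotency class is the least \<open>k\<close> at which it
  vanishes.
\<close>

primrec lie_lower_central :: "'a::ring set \<Rightarrow> nat \<Rightarrow> 'a set" where
  "lie_lower_central A 0 = A"
| "lie_lower_central A (Suc k) = lie_product (lie_lower_central A k) A"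

definition lie_nilpotent :: "'a::ring set \<Rightarrow> bool" where
  "lie_nilpotent A \<longleftrightarrow> (\<exists>k. lie_lower_central A k = {0})"

text \<open>Only meaningful for \<open>lie_nilpotent A\<close>.\<close>

definition lie_nilpotency_class :: "'a::ring set \<Rightarrow> nat" where
  "lie_nilpotency_class A = (LEAST k. lie_lower_central A k = {0})"

primrec lie_derived :: "'a::ring set \<Rightarrow> nat \<Rightarrow> 'a set" where
  "lie_derived A 0 = A"
| "lie_derived A (Suc k) = lie_product (lie_derived A k) (lie_derived A k)"

definition lie_solvable :: "'a::ring set \<Rightarrow> bool" where
  "lie_solvable A \<longleftrightarrow> (\<exists>k. lie_derived A k = {0})"

text \<open>Only meaningful for \<open>lie_solvable A\<close>.\<close>

definition lie_derived_length :: "'a::ring set \<Rightarrow> nat" where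
  "lie_derived_length A = (LEAST k. lie_derived A k = {0})"

end

theory Submission
  imports Defs
begin

text \<open>
  Let \<open>I\<close> be a right ideal, \<open>J\<close> the two-sided ideal it generates and \<open>N\<close> any two-sided ideal
  containing the \<open>(m + 2)\<close>-nd term of the lower central series of \<open>I\<close>; let \<open>Z\<close> be the
  \<open>(m + 1)\<close>-st term, so that \<open>Z\<close> is central in \<open>I\<close> modulo \<open>N\<close>.
  For \<open>x \<in> I\<close>, \<open>z \<in> Z\<close> and any \<open>r\<close> we have \<open>x[z,r] = [x,z]r + [z,xr] \<in> N\<close>, so \<open>[z,r]\<close> lies in
  the ideal \<open>T = {t. I t \<subseteq> N}\<close>, and \<open>J T \<subseteq> N\<close>.
  Modulo \<open>T\<close> the set \<open>Z\<close> is central in the whole ring, so the largest ideal \<open>K\<close> contained in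
  \<open>T + I\<close> contains \<open>Z\<close>. In \<open>I\<close> modulo \<open>T\<close> \<open>m + 1\<close> derived steps lead to \<open>0\<close>. One more step passes from \<open>J \<inter> T\<close>
  into \<open>N\<close>. Modulo \<open>K\<close> the class of \<open>I\<close> has dropped to \<open>m\<close>, and the
  derived lengths \<open>m + 2\<close> of the steps add up to the bound.
\<close>

section \<open>Additive subgroups, Lie products and the two Lie series\<close>

lemma additive_subgroup_zero: "additive_subgroup H \<Longrightarrow> 0 \<in> H"
  by (simp add: additive_subgroup_def)

lemma additive_subgroup_diff: "additive_subgroup H \<Longrightarrow> x \<in> H \<Longrightarrow> y \<in> H \<Longrightarrow> x - y \<in> H"
  by (simp add: additive_subgroup_def)

lemma additive_subgroup_uminus: "additive_subgroup H \<Longrightarrow> x \<in> H \<Longrightarrow> - x \<in> H"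
  using additive_subgroup_diff [of H 0 x] by (simp add: additive_subgroup_zero)

lemma additive_subgroup_add: "additive_subgroup H \<Longrightarrow> x \<in> H \<Longrightarrow> y \<in> H \<Longrightarrow> x + y \<in> H"
  using additive_subgroup_diff [of H x "- y"] by (simp add: additive_subgroup_uminus)

lemma additive_subgroup_sums:
  assumes "additive_subgroup H" and "additive_subgroup K"
  shows "additive_subgroup {x + y |x y. x \<in> H \<and> y \<in> K}"
  unfolding additive_subgroup_def
proof (intro conjI ballI)
  show "0 \<in> {x + y |x y. x \<in> H \<and> y \<in> K}"
    using assms by (force simp: additive_subgroup_def)
next
  fix u v
  assume "u \<in> {x + y |x y. x \<in> H \<and> y \<in> K}" and "v \<in> {x + y |x y. x \<in> H \<and> y \<in> K}"
  then obtain x y x' y' where "u = x + y" "x \<in> H" "y \<in> K" "v = x' + y'" "x' \<in> H" "y' \<in> K"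
    by blast
  moreover from this have "u - v = (x - x') + (y - y')"
    by simp
  ultimately show "u - v \<in> {x + y |x y. x \<in> H \<and> y \<in> K}"
    using assms additive_subgroup_diff by blast
qed

lemma additive_subgroup_group_closure: "additive_subgroup (group_closure S)"
  by (simp add: additive_subgroup_def group_closure.base group_closure.diff)

lemma additive_subgroup_lie_product: "additive_subgroup (lie_product X Y)"
  by (simp add: lie_product_def additive_subgroup_group_closure)

lemma lie_bracket_in_lie_product: "x \<in> X \<Longrightarrow> y \<in> Y \<Longrightarrow> lie_bracket x y \<in> lie_product X Y"
  unfolding lie_product_def
  by (rule group_closure.base) blast

lemma lie_product_subset:
  assumes "additive_subgroup H"
    and "\<And>x y. x \<in> X \<Longrightarrow> y \<in> Y \<Longrightarrow> lie_bracket x y \<in> H"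
  shows "lie_product X Y \<subseteq> H"
proof
  fix u assume "u \<in> lie_product X Y"
  then show "u \<in> H"
    unfolding lie_product_def
    by (induction rule: group_closure.induct)
      (use assms in \<open>auto simp: additive_subgroup_def\<close>)
qed

lemma additive_subgroup_lie_lower_central:
  "additive_subgroup A \<Longrightarrow> additive_subgroup (lie_lower_central A k)"
  by (cases k) (simp_all add: additive_subgroup_lie_product)

lemma additive_subgroup_lie_derived:
  "additive_subgroup A \<Longrightarrow> additive_subgroup (lie_derived A k)"
  by (cases k) (simp_all add: additive_subgroup_lie_product)

lemma lie_lower_central_subset:
  assumes "additive_subgroup A" and "\<And>x y. x \<in> A \<Longrightarrow> y \<in> A \<Longrightarrow> x * y \<in> A"
  shows "lie_lower_central A k \<subseteq> A"
proof (induction k)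
  case (Suc k)
  show ?case
    unfolding lie_lower_central.simps
  proof (rule lie_product_subset [OF assms(1)])
    show "lie_bracket x y \<in> A" if "x \<in> lie_lower_central A k" "y \<in> A" for x y
      unfolding lie_bracket_def
      using that Suc by (intro additive_subgroup_diff assms) blast+
  qed
qed simp

lemma lie_derived_subset:
  assumes "additive_subgroup A" and "\<And>x y. x \<in> A \<Longrightarrow> y \<in> A \<Longrightarrow> x * y \<in> A"
  shows "lie_derived A k \<subseteq> A"
proof (induction k)
  case (Suc k)
  show ?case
    unfolding lie_derived.simps
  proof (rule lie_product_subset [OF assms(1)])
    show "lie_bracket x y \<in> A" if "x \<in> lie_derived A k" "y \<in> lie_derived A k" for x y
      unfolding lie_bracket_def
      using that Suc by (intro additive_subgroup_diff assms) blast+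
  qed
qed simp

lemma lie_derived_add: "lie_derived A (j + k) = lie_derived (lie_derived A j) k"
  by (induction k) simp_all

section \<open>Two-sided ideals and computing modulo an ideal\<close>

lemma two_sided_ideal_iff:
  "two_sided_ideal N \<longleftrightarrow>
     additive_subgroup N \<and> (\<forall>r. \<forall>x\<in>N. r * x \<in> N) \<and> (\<forall>r. \<forall>x\<in>N. x * r \<in> N)"
  by (auto simp: two_sided_ideal_def left_ideal_def right_ideal_def)

lemma two_sided_idealD:
  assumes "two_sided_ideal N"
  shows two_sided_ideal_subgroup: "additive_subgroup N"
    and two_sided_ideal_mult_left: "x \<in> N \<Longrightarrow> r * x \<in> N"
    and two_sided_ideal_mult_right: "x \<in> N \<Longrightarrow> x * r \<in> N"
  using assms by (auto simp: two_sided_ideal_iff)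

text \<open>An intersection treats left and right ideals alike, and a property of all elements
  follows once the elements having it form an ideal containing \<open>X\<close>.\<close>

definition ideal_generated :: "'a::ring set \<Rightarrow> 'a set" where
  "ideal_generated X = \<Inter>{N. two_sided_ideal N \<and> X \<subseteq> N}"

lemma two_sided_ideal_generated: "two_sided_ideal (ideal_generated X)"
  unfolding ideal_generated_def two_sided_ideal_iff additive_subgroup_def by blast

lemma ideal_generated_superset: "X \<subseteq> ideal_generated X"
  unfolding ideal_generated_def by blast

lemma ideal_generated_least: "two_sided_ideal N \<Longrightarrow> X \<subseteq> N \<Longrightarrow> ideal_generated X \<subseteq> N"
  unfolding ideal_generated_def by blast

text \<open>When the bracket of \<open>t + x\<close> and \<open>t' + x'\<close> is expanded, all
  products with a factor from \<open>T\<close> stay in \<open>T\<close>. What remains is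
  \<open>lie_bracket x x'\<close>, for which it is enough that \<open>x'\<close> lies in
  \<open>A\<close>.\<close>

lemma lie_derived_modulo_ideal:
  assumes T: "two_sided_ideal T"
    and A: "additive_subgroup A" "\<And>x y. x \<in> A \<Longrightarrow> y \<in> A \<Longrightarrow> x * y \<in> A"
    and D: "D \<subseteq> {t + x |t x. t \<in> T \<and> x \<in> A}"
  shows "lie_derived D k \<subseteq> {t + x |t x. t \<in> T \<and> x \<in> lie_lower_central A k}"
proof (induction k)
  case 0
  then show ?case using D by simp
next
  case (Suc k)
  let ?S = "{t + x |t x. t \<in> T \<and> x \<in> lie_lower_central A (Suc k)}"
  note T_closed = two_sided_ideal_mult_left [OF T] two_sided_ideal_mult_right [OF T]
    additive_subgroup_add [OF two_sided_ideal_subgroup [OF T]]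
    additive_subgroup_diff [OF two_sided_ideal_subgroup [OF T]]
  have "lie_product (lie_derived D k) (lie_derived D k) \<subseteq> ?S"
  proof (rule lie_product_subset)
    show "additive_subgroup ?S"
      by (intro additive_subgroup_sums two_sided_ideal_subgroup T
          additive_subgroup_lie_lower_central A(1))
  next
    fix u v
    assume "u \<in> lie_derived D k" "v \<in> lie_derived D k"
    then obtain t x t' x' where u: "u = t + x" "t \<in> T" "x \<in> lie_lower_central A k"
      and v: "v = t' + x'" "t' \<in> T" "x' \<in> lie_lower_central A k"
      using Suc by blast
    have "lie_bracket u v =
        (t * (t' + x') - (t' + x') * t + (x * t' - t' * x)) + lie_bracket x x'"
      unfolding u v lie_bracket_def by (simp add: algebra_simps)
    moreover have "t * (t' + x') - (t' + x') * t + (x * t' - t' * x) \<in> T"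
      using u v by (intro T_closed)
    moreover have "lie_bracket x x' \<in> lie_lower_central A (Suc k)"
      using u v lie_lower_central_subset [OF A]
      by (auto intro!: lie_bracket_in_lie_product)
    ultimately show "lie_bracket u v \<in> ?S"
      by blast
  qed
  then show ?case by simp
qed

text \<open>
  The parameter \<open>mul\<close> is the multiplication of the ring or of its opposite, so that left and right
  ideals are treated at once.
\<close>

lemma annihilator_modulo_ideal:
  fixes mul :: "'a::ring \<Rightarrow> 'a \<Rightarrow> 'a" (infixl "\<odot>" 70)
  assumes mul: "mul = (*) \<or> mul = (\<lambda>x y. y * x)"
    and I: "additive_subgroup I" "\<And>x r. x \<in> I \<Longrightarrow> x \<odot> r \<in> I"
    and N: "two_sided_ideal N"
    and Z: "Z \<subseteq> I" "\<And>z x. z \<in> Z \<Longrightarrow> x \<in> I \<Longrightarrow> lie_bracket z x \<in> N"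
  obtains T K where "two_sided_ideal T" "N \<subseteq> T"
    and "\<forall>x \<in> ideal_generated I \<inter> T. \<forall>y \<in> ideal_generated I \<inter> T. x * y \<in> N"
    and "two_sided_ideal K" "Z \<subseteq> K" "K \<subseteq> {t + x |t x. t \<in> T \<and> x \<in> I}"
proof -
  have assoc: "x \<odot> y \<odot> z = x \<odot> (y \<odot> z)" for x y z
    using mul by (auto simp: mult.assoc)
  have distrib: "x \<odot> (y + z) = x \<odot> y + x \<odot> z" "(x + y) \<odot> z = x \<odot> z + y \<odot> z"
    "x \<odot> (y - z) = x \<odot> y - x \<odot> z" "(x - y) \<odot> z = x \<odot> z - y \<odot> z"
    "x \<odot> 0 = 0" "0 \<odot> x = 0" for x y z
    using mul by (auto simp: algebra_simps)
  have ideal_iff: "two_sided_ideal P \<longleftrightarrow>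
      additive_subgroup P \<and> (\<forall>r. \<forall>x\<in>P. r \<odot> x \<in> P) \<and> (\<forall>r. \<forall>x\<in>P. x \<odot> r \<in> P)" for P
    using mul by (auto simp: two_sided_ideal_iff)
  have N_sub: "additive_subgroup N" and N_mul: "x \<in> N \<Longrightarrow> r \<odot> x \<in> N" "x \<in> N \<Longrightarrow> x \<odot> r \<in> N" for x r
    using N by (auto simp: ideal_iff)
  note N_closed = N_mul additive_subgroup_zero [OF N_sub] additive_subgroup_diff [OF N_sub]
    additive_subgroup_add [OF N_sub]
  have ZN: "z \<odot> x - x \<odot> z \<in> N" "x \<odot> z - z \<odot> x \<in> N" if "z \<in> Z" "x \<in> I" for z x
  proof -
    have "z * x - x * z \<in> N" "x * z - z * x \<in> N"
      using Z(2) [OF that] additive_subgroup_uminus [OF N_sub Z(2) [OF that]]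
      by (simp_all add: lie_bracket_def)
    then show "z \<odot> x - x \<odot> z \<in> N" "x \<odot> z - z \<odot> x \<in> N"
      using mul by auto
  qed

  define T where "T = {t. \<forall>x\<in>I. x \<odot> t \<in> N}"
  define S where "S = {t + x |t x. t \<in> T \<and> x \<in> I}"
  \<comment> \<open>\<open>S\<close> absorbs right factors under \<open>\<odot>\<close>, so imposing
    left multiples is enough to make \<open>K\<close> an ideal.\<close>
  define K where "K = {y \<in> S. \<forall>r. r \<odot> y \<in> S}"

  have T: "two_sided_ideal T"
    using I(2) unfolding ideal_iff T_def additive_subgroup_def
    by (auto simp: distrib N_closed simp flip: assoc)
  have ZR_T: "r \<odot> z - z \<odot> r \<in> T" if "z \<in> Z" for r z
    unfolding T_def
  proof (intro CollectI ballI)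
    fix x assume x: "x \<in> I"
    \<comment> \<open>As \<open>x \<odot> r\<close> is in \<open>I\<close>, both commutators on the
      right pair \<open>z\<close> with an element of \<open>I\<close>, so \<open>ZN\<close> applies
      to each.\<close>
    have "x \<odot> (r \<odot> z - z \<odot> r) = (x \<odot> r \<odot> z - z \<odot> (x \<odot> r)) - (x \<odot> z - z \<odot> x) \<odot> r"
      by (simp add: distrib assoc)
    also have "\<dots> \<in> N"
      using that x I(2) by (intro N_closed ZN)
    finally show "x \<odot> (r \<odot> z - z \<odot> r) \<in> N" .
  qed
  \<comment> \<open>This set contains \<open>I\<close> by the choice of \<open>T\<close>; being an
    ideal, it contains all of \<open>ideal_generated I\<close>.\<close>
  have "two_sided_ideal {x. \<forall>t\<in>T. x \<odot> t \<in> N}"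
    using T unfolding ideal_iff additive_subgroup_def
    by (auto simp: distrib N_closed assoc)
  then have "ideal_generated I \<subseteq> {x. \<forall>t\<in>T. x \<odot> t \<in> N}"
    by (rule ideal_generated_least) (auto simp: T_def)
  \<comment> \<open>Taking both factors from the intersection makes the claim insensitive to the
    order in \<open>mul\<close>.\<close>
  then have JT: "\<forall>x \<in> ideal_generated I \<inter> T. \<forall>y \<in> ideal_generated I \<inter> T. x * y \<in> N"
    using mul by auto

  have S_sub: "additive_subgroup S"
    unfolding S_def by (intro additive_subgroup_sums two_sided_ideal_subgroup T I(1))
  have S_mul: "y \<odot> r \<in> S" if "y \<in> S" for y r
    using that T I(2) unfolding S_def ideal_iff by (fastforce simp: distrib)
  have K: "two_sided_ideal K"
    using S_sub S_mul unfolding ideal_iff K_def additive_subgroup_def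
    by (auto simp: distrib simp flip: assoc)
  have "Z \<subseteq> K"
  proof
    fix z assume z: "z \<in> Z"
    have "z = 0 + z"
      by simp
    then have "z \<in> S"
      using z Z(1) additive_subgroup_zero [OF two_sided_ideal_subgroup [OF T]]
      unfolding S_def by blast
    moreover have "r \<odot> z \<in> S" for r
    proof -
      have "r \<odot> z = (r \<odot> z - z \<odot> r) + z \<odot> r"
        by simp
      then show ?thesis
        using z Z(1) I(2) ZR_T unfolding S_def by blast
    qed
    ultimately show "z \<in> K"
      by (simp add: K_def)
  qed
  moreover have "N \<subseteq> T"
    by (auto simp: T_def N_closed)
  moreover have "K \<subseteq> {t + x |t x. t \<in> T \<and> x \<in> I}"
    by (auto simp: K_def S_def)
  ultimately show ?thesis
    using T JT K by (intro that)
qed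

section \<open>Induction on the class and the theorem\<close>

text \<open>Stated modulo an ideal \<open>N\<close> because the induction on \<open>m\<close> keeps
  \<open>I\<close> fixed and applies its hypothesis to another ideal \<open>K\<close>, which absorbs
  one more term of the lower central series.\<close>

lemma lie_derived_ideal_generated_subset:
  fixes mul :: "'a::ring \<Rightarrow> 'a \<Rightarrow> 'a"
  assumes mul: "mul = (*) \<or> mul = (\<lambda>x y. y * x)"
    and I: "additive_subgroup I" "\<And>x r. x \<in> I \<Longrightarrow> mul x r \<in> I"
    and N: "two_sided_ideal N" "lie_lower_central I m \<subseteq> N"
  shows "lie_derived (ideal_generated I) (m * (m + 1) div 2 + m) \<subseteq> N"
  using N
proof (induction m arbitrary: N)
  case 0
  then show ?case
    by (simp add: ideal_generated_least)
next
  case (Suc m)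
  let ?J = "ideal_generated I" and ?Z = "lie_lower_central I m"
  let ?D = "lie_derived ?J (m * (m + 1) div 2 + m)"
  have I_mult: "x * y \<in> I" if "x \<in> I" "y \<in> I" for x y
    using mul I(2) that by auto
  have Z_N: "lie_bracket z x \<in> N" if "z \<in> ?Z" "x \<in> I" for z x
    using that Suc.prems(2) lie_bracket_in_lie_product by fastforce
  obtain T K where T: "two_sided_ideal T" "N \<subseteq> T"
    and JT: "\<forall>x \<in> ?J \<inter> T. \<forall>y \<in> ?J \<inter> T. x * y \<in> N"
    and K: "two_sided_ideal K" "?Z \<subseteq> K" "K \<subseteq> {t + x |t x. t \<in> T \<and> x \<in> I}"
    by (rule annihilator_modulo_ideal
        [OF mul I Suc.prems(1) lie_lower_central_subset [OF I(1) I_mult] Z_N])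
  have D: "?D \<subseteq> {t + x |t x. t \<in> T \<and> x \<in> I}"
    using Suc.IH [OF K(1,2)] K(3) by blast
  have "lie_derived ?D (Suc m) \<subseteq> {t + x |t x. t \<in> T \<and> x \<in> lie_lower_central I (Suc m)}"
    by (rule lie_derived_modulo_ideal [OF T(1) I(1) I_mult D])
  also have "\<dots> \<subseteq> T"
    using Suc.prems(2) T(2) additive_subgroup_add [OF two_sided_ideal_subgroup [OF T(1)]]
    by blast
  finally have D_T: "lie_derived ?D (Suc m) \<subseteq> T" .
  \<comment> \<open>The last step rests on \<open>JT\<close>, which asks for membership in
    \<open>?J\<close> besides \<open>T\<close>.\<close>
  have D_J: "lie_derived ?D (Suc m) \<subseteq> ?J"
    unfolding lie_derived_add [symmetric]
    using two_sided_idealD [OF two_sided_ideal_generated] by (intro lie_derived_subset)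
  \<comment> \<open>The triangular number grows by \<open>m + 1\<close> and the linear term by
    \<open>1\<close>: \<open>Suc m\<close> steps lead into \<open>T\<close>, one more into
    \<open>N\<close>.\<close>
  have len: "Suc m * (Suc m + 1) div 2 + Suc m = (m * (m + 1) div 2 + m) + Suc (Suc m)"
    by simp
  have "lie_derived ?J (Suc m * (Suc m + 1) div 2 + Suc m)
      = lie_product (lie_derived ?D (Suc m)) (lie_derived ?D (Suc m))"
    unfolding len lie_derived_add by simp
  also have "\<dots> \<subseteq> N"
  proof (rule lie_product_subset)
    show N_sub: "additive_subgroup N"
      by (rule two_sided_ideal_subgroup [OF Suc.prems(1)])
    show "lie_bracket x y \<in> N"
      if "x \<in> lie_derived ?D (Suc m)" "y \<in> lie_derived ?D (Suc m)" for x y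
      unfolding lie_bracket_def
      using that D_T D_J JT by (intro additive_subgroup_diff [OF N_sub]) blast+
  qed
  finally show ?case .
qed

theorem theorem1:
  fixes I :: "'a::ring set"
  assumes "left_ideal I \<or> right_ideal I"
    and "lie_nilpotent I"
    and "m = lie_nilpotency_class I"
  shows "\<exists>J. two_sided_ideal J \<and> I \<subseteq> J \<and> lie_solvable J \<and>
           lie_derived_length J \<le> m * (m + 1) div 2 + m"
proof -
  let ?J = "ideal_generated I" and ?s = "m * (m + 1) div 2 + m"
  have m: "lie_lower_central I m \<subseteq> {0}"
    using assms(2,3) LeastI_ex [of "\<lambda>k. lie_lower_central I k = {0}"]
    by (simp add: lie_nilpotent_def lie_nilpotency_class_def)
  \<comment> \<open>The zero ideal serves as \<open>N\<close>, so that the general statement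
    concerns \<open>I\<close> itself.\<close>
  have zero: "two_sided_ideal ({0} :: 'a set)"
    by (simp add: two_sided_ideal_iff additive_subgroup_def)
  have "lie_derived ?J ?s \<subseteq> {0}"
    using assms(1)
  proof
    \<comment> \<open>Under the opposite multiplication \<open>I\<close> is a right ideal, while
      \<open>ideal_generated\<close> and \<open>lie_derived\<close> still refer to the original
      ring.\<close>
    assume "left_ideal I"
    then show ?thesis
      using lie_derived_ideal_generated_subset [of "\<lambda>x y. y * x", OF _ _ _ zero m]
      by (simp add: left_ideal_def)
  next
    assume "right_ideal I"
    then show ?thesis
      using lie_derived_ideal_generated_subset [of "(*)", OF _ _ _ zero m]
      by (simp add: right_ideal_def)
  qed
  moreover have "0 \<in> lie_derived ?J ?s"
    by (intro additive_subgroup_zero additive_subgroup_lie_derived two_sided_ideal_subgroup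
        two_sided_ideal_generated)
  ultimately have s: "lie_derived ?J ?s = {0}"
    by blast
  then have "lie_solvable ?J" and "lie_derived_length ?J \<le> ?s"
    unfolding lie_solvable_def lie_derived_length_def by (blast, rule Least_le)
  then show ?thesis
    using two_sided_ideal_generated ideal_generated_superset by blast
qed

end
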